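(* Let $X$ and $Y$ be $\mathbb{R}$-linear spaces and let $g:X\to Y$ be a mapping such that there are $a^*,a^*_0,a^*_1\in X$ for which $g(a^*_0)-g(a^* )$ and $g(a^*_1)-g(a^* )$ are linearly independent. Then $g$ is an affine mapping if and only if $g$ satisfies both of the following conditions: (i) for every line $L\subseteq X$, the image $g[L]$ is either a point or a line in $Y$; and (ii) for all $a,b,c\in X$ with $c\in (a,b)$, either $g(a)=g(b)=g(c)$ or $g(c)\in (g(a),g(b))$.
   Context: An $\mathbb{R}$-linear space is a vector space over $\mathbb{R}$ (of arbitrary, possibly infinite, dimension). A mapping $g:X\to Y$ is affine if there are an $\mathbb{R}$-linear mapping $f:X\to Y$ and $b\in Y$ such that $g(a)=f(a)+b$ for all $a\in X$. A subset of a linear space is a point if it is a singleton. A line is an affine subspace of dimension $1$, i.e. a set of the form $\{rd+a : r\in\mathbb{R}\}$ with $d\neq 0$. For $U\subseteq X$, $g[U]=\{g(u):u\in U\}$. For vectors $a,b$ in a linear space, $(a,b)$ denotes the open interval between them: $(a,b)=\{t(b-a)+a : 0\le t\le 1\}\setminus\{a,b\}$; in particular $(a,a)=\emptyset$. *)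

theory Defs
  imports "HOL-Analysis.Analysis"
begin

definition affine_map :: "('a::real_vector \<Rightarrow> 'b::real_vector) \<Rightarrow> bool" where
  "affine_map g \<longleftrightarrow> (\<exists>f b. linear f \<and> (\<forall>a. g a = f a + b))"

definition is_line :: "'a::real_vector set \<Rightarrow> bool" where
  "is_line L \<longleftrightarrow> (\<exists>d a. d \<noteq> 0 \<and> L = {r *\<^sub>R d + a | r. True})"

end

theory Submission
  imports Defs
begin

text \<open>
  The easy direction is that an affine map sends a line \<open>{r d + a}\<close> to
  \<open>{r f(d) + g(a)}\<close>, which is a line or, if \<open>f(d) = 0\<close>, a point, and that it keeps the ratio
  in which a point divides a segment.

  For the converse, betweenness makes \<open>g\<close> either constant or injective on each line:
  if \<open>g\<close> agrees at two points, it is constant on the segment between them, and a point beyond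
  with a different value would put one of two equal values strictly between the other and that
  value (\<open>const_on_line\<close>).  By the condition on lines, a line on which \<open>g\<close> is not
  constant is mapped bijectively onto the line through the images of any two of its points, so
  incidences can be followed in both directions.

  The heart of the proof is that parallelograms are preserved when the image of the first corner
  and those of its two neighbours are not collinear.  Put the first corner and its image
  at the origin, and let the sides be \<open>u\<close> and \<open>v\<close>.
  The fourth corner \<open>u + v\<close> lies on the ray through the midpoint of \<open>u\<close> and \<open>v\<close>, so its image
  is in the plane spanned by \<open>g(u)\<close> and \<open>g(v)\<close>.  The parallel lines
  \<open>u + \<real>v\<close> and \<open>\<real>v\<close> have disjoint images: a common value would be the constant value of
  \<open>g\<close> on a line which meets two sides of the triangle \<open>0\<close>, \<open>u\<close>, \<open>v\<close>,
  possibly extended or halved, whose images do not share that value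
  (\<open>parallel_images_disjoint\<close>).  The images are full lines in a common plane, so they are parallel
  too, and the same holds for the other pair of sides.  This gives \<open>g(u + v) = g(u) + g(v)\<close>
  (\<open>add_if_independent\<close>).

  Midpoints are where the diagonals of a parallelogram meet.  Every pair \<open>a\<close>, \<open>b\<close> with
  \<open>g(a) \<noteq> g(b)\<close> spans a diagonal of a parallelogram of the above kind, because the image of
  \<open>g\<close> is not contained in the line through \<open>g(a)\<close> and \<open>g(b)\<close>; hence, with constancy on
  lines for the remaining pairs, \<open>g\<close> preserves all midpoints (\<open>midpoint_preserved\<close>),
  and \<open>g - g(0)\<close> is additive.  Finally, on each line
  through the origin an additive map acts on the real parameter as an additive function that, by
  betweenness, preserves positivity.  Such a function is monotone and fixes the rationals, so it is
  the identity, and \<open>g - g(0)\<close> is linear.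
\<close>

section \<open>Segments and coordinates\<close>

lemma in_open_segmentI:
  fixes a b c :: "'a::real_vector"
  assumes "s > 0" "t > 0" "a \<noteq> b" and eq: "(s + t) *\<^sub>R c = s *\<^sub>R a + t *\<^sub>R b"
  shows "c \<in> open_segment a b"
proof -
  have "c = (1 / (s + t)) *\<^sub>R ((s + t) *\<^sub>R c)"
    using assms(1,2) by simp
  also have "\<dots> = (s / (s + t)) *\<^sub>R a + (t / (s + t)) *\<^sub>R b"
    unfolding eq by (simp add: scaleR_add_right)
  also have "s / (s + t) = 1 - t / (s + t)"
    using assms(1,2) by (simp add: field_simps)
  finally show ?thesis
    using assms(1-3) by (auto simp: in_segment intro!: exI[of _ "t / (s + t)"])
qed

lemma half_sum_on_line:
  fixes a b :: "'a::real_vector"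
  shows "(1 / 2) *\<^sub>R (a + b) = a + (1 / 2) *\<^sub>R (b - a)"
  by (simp add: algebra_simps flip: scaleR_add_left)

lemma independent_pair_iff:
  fixes x y :: "'a::real_vector"
  shows "x \<noteq> y \<and> independent {x, y} \<longleftrightarrow>
    (\<forall>\<alpha> \<beta>. \<alpha> *\<^sub>R x + \<beta> *\<^sub>R y = 0 \<longrightarrow> \<alpha> = 0 \<and> \<beta> = 0)"
proof (intro iffI allI impI)
  fix \<alpha> \<beta> :: real
  assume *: "x \<noteq> y \<and> independent {x, y}" and "\<alpha> *\<^sub>R x + \<beta> *\<^sub>R y = 0"
  then have eq: "\<alpha> *\<^sub>R x = (- \<beta>) *\<^sub>R y"
    by (simp add: eq_neg_iff_add_eq_0)
  have "x \<notin> span {y}" "y \<noteq> 0"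
    using * by (auto simp: independent_insert)
  have "\<alpha> = 0"
  proof (rule ccontr)
    assume "\<alpha> \<noteq> 0"
    then have "x = (1 / \<alpha>) *\<^sub>R (\<alpha> *\<^sub>R x)"
      by simp
    also have "\<dots> = (- \<beta> / \<alpha>) *\<^sub>R y"
      by (simp add: eq)
    finally show False
      using \<open>x \<notin> span {y}\<close> unfolding span_singleton by blast
  qed
  then show "\<alpha> = 0 \<and> \<beta> = 0"
    using eq \<open>y \<noteq> 0\<close> by simp
next
  assume *: "\<forall>\<alpha> \<beta>. \<alpha> *\<^sub>R x + \<beta> *\<^sub>R y = 0 \<longrightarrow> \<alpha> = 0 \<and> \<beta> = 0"
  have "x \<noteq> y"
    using *[rule_format, of 1 "-1"] by auto
  moreover have "y \<noteq> 0"
    using *[rule_format, of 0 1] by auto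
  moreover have "x \<notin> span {y}"
  proof
    assume "x \<in> span {y}"
    then obtain k where "x = k *\<^sub>R y"
      by (auto simp: span_singleton)
    then show False
      using *[rule_format, of 1 "-k"] by simp
  qed
  ultimately show "x \<noteq> y \<and> independent {x, y}"
    by (auto simp: independent_insert)
qed

lemma independent_pair_coords_unique:
  fixes x y :: "'a::real_vector"
  assumes "x \<noteq> y \<and> independent {x, y}"
    and "\<alpha> *\<^sub>R x + \<beta> *\<^sub>R y = \<gamma> *\<^sub>R x + \<delta> *\<^sub>R y"
  shows "\<alpha> = \<gamma>" and "\<beta> = \<delta>"
proof -
  have "(\<alpha> - \<gamma>) *\<^sub>R x + (\<beta> - \<delta>) *\<^sub>R y = 0"
    using assms(2) by (simp add: algebra_simps)
  then have "\<alpha> - \<gamma> = 0 \<and> \<beta> - \<delta> = 0"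
    using assms(1) unfolding independent_pair_iff by blast
  then show "\<alpha> = \<gamma>" "\<beta> = \<delta>"
    by auto
qed

section \<open>Affine maps preserve lines and betweenness\<close>

lemma affine_map_image_line:
  assumes "affine_map g" "is_line L"
  shows "is_singleton (g ` L) \<or> is_line (g ` L)"
proof -
  obtain f b where f: "linear f" "\<And>x. g x = f x + b"
    using assms(1) by (auto simp: affine_map_def)
  obtain d a where L: "L = {r *\<^sub>R d + a | r. True}"
    using assms(2) by (auto simp: is_line_def)
  have "g ` L = {g (r *\<^sub>R d + a) | r. True}"
    unfolding L by blast
  then have img: "g ` L = {r *\<^sub>R f d + (f a + b) | r. True}"
    by (simp add: f(2) linear_add[OF f(1)] linear_scale[OF f(1)] add.assoc)
  show ?thesis
  proof (cases "f d = 0")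
    case True
    then show ?thesis
      by (simp add: img is_singleton_def)
  next
    case False
    then show ?thesis
      unfolding is_line_def img by blast
  qed
qed

lemma affine_map_open_segment:
  assumes "affine_map g" "c \<in> open_segment a b"
  shows "(g a = g b \<and> g b = g c) \<or> g c \<in> open_segment (g a) (g b)"
proof -
  obtain f e where f: "linear f" "\<And>x. g x = f x + e"
    using assms(1) by (auto simp: affine_map_def)
  obtain u where u: "0 < u" "u < 1" "c = (1 - u) *\<^sub>R a + u *\<^sub>R b"
    using assms(2) by (auto simp: in_segment)
  have "f c = (1 - u) *\<^sub>R f a + u *\<^sub>R f b"
    unfolding u(3) using f(1) by (simp add: linear_add linear_scale)
  then have gc: "g c = (1 - u) *\<^sub>R g a + u *\<^sub>R g b"
    by (simp add: f(2) algebra_simps)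
  show ?thesis
  proof (cases "g a = g b")
    case True
    then show ?thesis
      using gc by (simp flip: scaleR_add_left)
  next
    case False
    then show ?thesis
      using gc u by (auto simp: in_segment)
  qed
qed

section \<open>Maps preserving lines and betweenness\<close>

locale line_betweenness_map =
  fixes g :: "'a::real_vector \<Rightarrow> 'b::real_vector"
  assumes image_line: "is_line L \<Longrightarrow> is_singleton (g ` L) \<or> is_line (g ` L)"
    and image_between: "c \<in> open_segment a b \<Longrightarrow>
      (g a = g b \<and> g b = g c) \<or> g c \<in> open_segment (g a) (g b)"
begin

text \<open>
  A point \<open>p\<close> outside the segment from \<open>a\<close> to \<open>b\<close> leaves one of \<open>a\<close>, \<open>b\<close> strictly between
  \<open>p\<close> and the other one.  If \<open>g p\<close> differed from the common value, that value would lie in an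
  open segment of which it is an endpoint.
\<close>

lemma const_on_line:
  assumes "g a = g b" "a \<noteq> b"
  shows "g (a + r *\<^sub>R (b - a)) = g a"
proof -
  define p where "p = a + r *\<^sub>R (b - a)"
  consider "r = 0" | "r = 1" | "0 < r" "r < 1" | "1 < r" | "r < 0"
    by linarith
  then have "g p = g a"
  proof cases
    case 3
    then have "p \<in> open_segment a b"
      using assms(2) by (auto simp: in_segment p_def algebra_simps)
    then show ?thesis
      using image_between[of p a b] assms by auto
  next
    case 4
    have "r *\<^sub>R b = (r - 1) *\<^sub>R a + p"
      by (simp add: p_def algebra_simps)
    moreover have "a \<noteq> p"
      using 4 assms by (simp add: p_def)
    ultimately have "b \<in> open_segment a p"
      using 4 by (intro in_open_segmentI[of "r - 1" 1]) auto
    moreover have "g b \<notin> open_segment (g a) (g p)"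
      using assms(1) by (simp add: open_segment_def)
    ultimately show ?thesis
      using image_between by metis
  next
    case 5
    have "(1 - r) *\<^sub>R a = (- r) *\<^sub>R b + p"
      by (simp add: p_def algebra_simps)
    moreover have "b - p = (1 - r) *\<^sub>R (b - a)"
      by (simp add: p_def algebra_simps)
    then have "b \<noteq> p"
      using 5 assms by auto
    ultimately have "a \<in> open_segment b p"
      using 5 by (intro in_open_segmentI[of "- r" 1]) auto
    moreover have "g a \<notin> open_segment (g b) (g p)"
      using assms(1) by (simp add: open_segment_def)
    ultimately show ?thesis
      using image_between assms(1) by metis
  qed (auto simp: p_def assms)
  then show ?thesis
    by (simp add: p_def)
qed

lemma image_of_line_through:
  assumes "g a \<noteq> g b"
  shows "g ` {a + r *\<^sub>R (b - a) | r. True} = {g a + s *\<^sub>R (g b - g a) | s. True}"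
proof -
  let ?L = "{a + r *\<^sub>R (b - a) | r. True}"
  have "?L = {r *\<^sub>R (b - a) + a | r. True}"
    by (simp add: add.commute)
  moreover have "b - a \<noteq> 0"
    using assms by auto
  ultimately have "is_line ?L"
    unfolding is_line_def by blast
  have mem: "a \<in> ?L" "b \<in> ?L"
    by (auto intro: exI[of _ 0] exI[of _ 1])
  then have img_mem: "g a \<in> g ` ?L" "g b \<in> g ` ?L"
    using imageI by fast+
  have "\<not> is_singleton (g ` ?L)"
  proof
    assume "is_singleton (g ` ?L)"
    then obtain y where "g ` ?L = {y}"
      by (rule is_singletonE)
    then show False
      using img_mem assms by (metis singletonD)
  qed
  then have "is_line (g ` ?L)"
    using image_line \<open>is_line ?L\<close> by blast
  then obtain d e where img: "g ` ?L = {r *\<^sub>R d + e | r. True}"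
    unfolding is_line_def by blast
  from img_mem have "g a \<in> {r *\<^sub>R d + e | r. True}" "g b \<in> {r *\<^sub>R d + e | r. True}"
    unfolding img .
  then obtain r0 r1 where r: "g a = r0 *\<^sub>R d + e" "g b = r1 *\<^sub>R d + e"
    by auto
  have ne: "r1 - r0 \<noteq> 0"
    using assms r by auto
  have "g a + s *\<^sub>R (g b - g a) = (r0 + s * (r1 - r0)) *\<^sub>R d + e" for s
    by (simp add: r algebra_simps)
  moreover have "t *\<^sub>R d + e = g a + ((t - r0) / (r1 - r0)) *\<^sub>R (g b - g a)" for t
  proof -
    have "g b - g a = (r1 - r0) *\<^sub>R d"
      by (simp add: r algebra_simps)
    then have "((t - r0) / (r1 - r0)) *\<^sub>R (g b - g a) = (t - r0) *\<^sub>R d"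
      using ne by simp
    then show ?thesis
      by (simp only: r) (simp add: scaleR_diff_left)
  qed
  ultimately show ?thesis
    unfolding img by blast
qed

lemma image_on_line: "\<exists>s. g (a + r *\<^sub>R (b - a)) = g a + s *\<^sub>R (g b - g a)"
proof (cases "g a = g b")
  case True
  then show ?thesis
    using const_on_line[of a b r] by (cases "a = b") auto
next
  case False
  then show ?thesis
    using image_of_line_through[OF False] by blast
qed

lemma image_onto_line:
  assumes "g a \<noteq> g b"
  shows "\<exists>r. g (a + r *\<^sub>R (b - a)) = g a + s *\<^sub>R (g b - g a)"
proof -
  have "g a + s *\<^sub>R (g b - g a) \<in> g ` {a + r *\<^sub>R (b - a) | r. True}"
    unfolding image_of_line_through[OF assms] by blast
  then show ?thesis
    by force
qed

text \<open>This allows any point and its image to be taken as the origins.\<close>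

lemma translate: "line_betweenness_map (\<lambda>x. g (c + x) - g c)"
proof
  fix L :: "'a set"
  assume "is_line L"
  then obtain d a where L: "d \<noteq> 0" "L = {r *\<^sub>R d + a | r. True}"
    unfolding is_line_def by blast
  have "(+) c ` L = {r *\<^sub>R d + (c + a) | r. True}"
    by (auto simp: L image_iff algebra_simps)
  then have line: "is_line ((+) c ` L)"
    using L(1) unfolding is_line_def by blast
  have eq: "(\<lambda>x. g (c + x) - g c) ` L = (\<lambda>y. y - g c) ` g ` (+) c ` L"
    by (simp add: image_image)
  from image_line[OF line] show "is_singleton ((\<lambda>x. g (c + x) - g c) ` L) \<or> is_line ((\<lambda>x. g (c + x) - g c) ` L)"
  proof
    assume "is_singleton (g ` (+) c ` L)"
    then show ?thesis
      unfolding eq by (auto simp: is_singleton_def)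
  next
    assume "is_line (g ` (+) c ` L)"
    then obtain d' a' where L': "d' \<noteq> 0" "g ` (+) c ` L = {r *\<^sub>R d' + a' | r. True}"
      unfolding is_line_def by blast
    have "(\<lambda>y. y - g c) ` g ` (+) c ` L = {r *\<^sub>R d' + (a' - g c) | r. True}"
      unfolding L'(2) by (auto simp: image_iff algebra_simps) 
    then show ?thesis
      using L'(1) unfolding eq is_line_def by blast
  qed
next
  fix x a b :: 'a
  assume "x \<in> open_segment a b"
  then have "c + x \<in> open_segment (c + a) (c + b)"
    by (simp add: open_segment_translation_eq)
  then have "(g (c + a) = g (c + b) \<and> g (c + b) = g (c + x)) \<or> g (c + x) \<in> open_segment (g (c + a)) (g (c + b))"
    by (rule image_between)
  moreover have "y - g c \<in> open_segment (p - g c) (q - g c) \<longleftrightarrow> y \<in> open_segment p q" for y p q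
    using open_segment_translation_eq[of "- g c" y p q] by simp
  ultimately show "(g (c + a) - g c = g (c + b) - g c \<and> g (c + b) - g c = g (c + x) - g c)
     \<or> g (c + x) - g c \<in> open_segment (g (c + a) - g c) (g (c + b) - g c)"
    by auto
qed

end

section \<open>Parallelograms\<close>

locale pointed_line_betweenness_map = line_betweenness_map +
  assumes zero [simp]: "g 0 = 0"
begin

lemma image_scaleR: "\<exists>s. g (r *\<^sub>R u) = s *\<^sub>R g u"
  using image_on_line[of 0 r u] by auto

lemma image_scaleR_eq_0_D:
  assumes "g (r *\<^sub>R u) = 0" "g u \<noteq> 0"
  shows "r = 0"
proof (rule ccontr)
  assume "r \<noteq> 0"
  moreover have "u \<noteq> 0"
    using assms by auto
  ultimately show False
    using const_on_line[of 0 "r *\<^sub>R u" "1 / r"] assms by simp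
qed

lemma image_scaleR_eq_self_D:
  assumes "g (r *\<^sub>R u) = g u" "g u \<noteq> 0"
  shows "r = 1"
proof (rule ccontr)
  assume r: "r \<noteq> 1"
  have "u - r *\<^sub>R u = (1 - r) *\<^sub>R u"
    by (simp add: scaleR_diff_left)
  moreover have "u \<noteq> 0"
    using assms by auto
  ultimately have "u \<noteq> r *\<^sub>R u"
    using r by auto
  moreover have "u + (1 / (1 - r)) *\<^sub>R (r *\<^sub>R u - u) = 0"
  proof -
    have "r *\<^sub>R u - u = - ((1 - r) *\<^sub>R u)"
      by (simp add: algebra_simps)
    then show ?thesis
      using r by simp
  qed
  ultimately show False
    using const_on_line[of u "r *\<^sub>R u" "1 / (1 - r)"] assms by simp
qed

text \<open>
  The lines through \<open>0\<close> and through \<open>u\<close> in direction \<open>v\<close> cannot have a common image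
  point: otherwise \<open>g\<close> is constant on a transversal of the two lines.  The transversal meets the
  line through \<open>0\<close> and \<open>u\<close> or is parallel to it; and it meets the line through \<open>u\<close> and \<open>v\<close> or is
  parallel to it.  Each meeting point restricts the constant value to another side of the triangle
  \<open>g 0\<close>, \<open>g u\<close>, \<open>g v\<close>, and two sides have only a corner in common.  Where a meeting point is
  lacking, halving \<open>u\<close> or \<open>v\<close> supplies a line that does meet the transversal.
\<close>

lemma parallel_images_disjoint:
  assumes ind: "g u \<noteq> g v \<and> independent {g u, g v}"
  shows "g (u + s *\<^sub>R v) \<noteq> g (t *\<^sub>R v)"
proof
  assume eq: "g (u + s *\<^sub>R v) = g (t *\<^sub>R v)"
  note coords = independent_pair_coords_unique[OF ind]
  have nz: "g u \<noteq> 0" "g v \<noteq> 0"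
    using ind dependent_zero[of "{g u, g v}"] by auto
  obtain \<tau> where \<tau>: "g (t *\<^sub>R v) = \<tau> *\<^sub>R g v"
    using image_scaleR by blast
  have "t *\<^sub>R v \<noteq> u + s *\<^sub>R v"
  proof
    assume "t *\<^sub>R v = u + s *\<^sub>R v"
    then have "u = (t - s) *\<^sub>R v"
      by (simp add: algebra_simps)
    then obtain k where "g u = k *\<^sub>R g v"
      using image_scaleR by metis
    then show False
      using coords(1)[of 1 0 0 k] by simp
  qed
  then have const: "g (t *\<^sub>R v + r *\<^sub>R (u + (s - t) *\<^sub>R v)) = \<tau> *\<^sub>R g v" for r
    using const_on_line[of "t *\<^sub>R v" "u + s *\<^sub>R v" r] eq \<tau> by (simp add: algebra_simps)
  show False
  proof (cases "s = t")
    case False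
    \<comment> \<open>The transversal meets the line through \<open>0\<close> and \<open>u\<close>, so the constant value is \<open>0\<close>,
      and injectivity along \<open>v\<close> forces the transversal through the origin.\<close>
    have "t *\<^sub>R v + (- t / (s - t)) *\<^sub>R (u + (s - t) *\<^sub>R v) = (- t / (s - t)) *\<^sub>R u"
      using False by (simp add: scaleR_add_right)
    then obtain \<sigma> where "\<tau> *\<^sub>R g v = \<sigma> *\<^sub>R g u"
      using const image_scaleR by metis
    then have "\<tau> = 0"
      using coords(2)[of 0 \<tau> \<sigma> 0] by simp
    then have t: "t = 0"
      using \<tau> image_scaleR_eq_0_D nz by simp
    have const0: "g (r *\<^sub>R (u + s *\<^sub>R v)) = 0" for r
      using const[of r] by (simp add: t \<open>\<tau> = 0\<close>)
    show False
    proof (cases "s = -1")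
      case True
      \<comment> \<open>The transversal is parallel to the line through \<open>u\<close> and \<open>v\<close>, but the line through
        \<open>v\<close> and \<open>u / 2\<close> meets it in \<open>u - v\<close>, so \<open>g (u / 2)\<close> is a multiple of \<open>g v\<close>.\<close>
      have "(1 / 2) *\<^sub>R u = v + (1 / 2) *\<^sub>R ((u - v) - v)"
        by (simp add: algebra_simps flip: scaleR_add_left)
      then obtain k where "g ((1 / 2) *\<^sub>R u) = g v + k *\<^sub>R (g (u - v) - g v)"
        using image_on_line by metis
      moreover have "g (u - v) = 0"
        using const0[of 1] True by simp
      moreover obtain \<sigma> where \<sigma>: "g ((1 / 2) *\<^sub>R u) = \<sigma> *\<^sub>R g u"
        using image_scaleR by blast
      ultimately have "\<sigma> *\<^sub>R g u + 0 *\<^sub>R g v = 0 *\<^sub>R g u + (1 - k) *\<^sub>R g v"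
        by (simp add: algebra_simps)
      then have "\<sigma> = 0"
        by (rule coords(1))
      then show False
        using \<sigma> image_scaleR_eq_0_D[of "1 / 2" u] nz by simp
    next
      case False
      then have s: "1 + s \<noteq> 0"
        by simp
      \<comment> \<open>The transversal meets the line through \<open>u\<close> and \<open>v\<close>, whose image avoids \<open>0\<close>.\<close>
      have "(1 / (1 + s)) *\<^sub>R (u + s *\<^sub>R v) = (1 / (1 + s)) *\<^sub>R u + (s / (1 + s)) *\<^sub>R v"
        by (simp add: scaleR_add_right)
      moreover have "1 / (1 + s) = 1 - s / (1 + s)"
        using s by (simp add: field_simps)
      moreover have "(1 - s / (1 + s)) *\<^sub>R u + (s / (1 + s)) *\<^sub>R v = u + (s / (1 + s)) *\<^sub>R (v - u)"
        by (simp add: scaleR_diff_left scaleR_diff_right)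
      ultimately have "(1 / (1 + s)) *\<^sub>R (u + s *\<^sub>R v) = u + (s / (1 + s)) *\<^sub>R (v - u)"
        by metis
      then obtain k where "g ((1 / (1 + s)) *\<^sub>R (u + s *\<^sub>R v)) = g u + k *\<^sub>R (g v - g u)"
        using image_on_line by metis
      then have *: "(1 - k) *\<^sub>R g u + k *\<^sub>R g v = 0 *\<^sub>R g u + 0 *\<^sub>R g v"
        unfolding const0 by (simp add: algebra_simps)
      then show False
        using coords(1)[OF *] coords(2)[OF *] by simp
    qed
  next
    case True
    \<comment> \<open>The transversal has direction \<open>u\<close>.  It meets the line through \<open>u\<close> and \<open>v\<close>,
      so the constant value is \<open>g v\<close>.\<close>
    have const': "g (t *\<^sub>R v + r *\<^sub>R u) = \<tau> *\<^sub>R g v" for r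
      using const[of r] True by simp
    have "t *\<^sub>R v + (1 - t) *\<^sub>R u = v + (1 - t) *\<^sub>R (u - v)"
      by (simp add: algebra_simps)
    then obtain k where "\<tau> *\<^sub>R g v = g v + k *\<^sub>R (g u - g v)"
      using image_on_line const' by metis
    then have *: "0 *\<^sub>R g u + \<tau> *\<^sub>R g v = k *\<^sub>R g u + (1 - k) *\<^sub>R g v"
      by (simp add: algebra_simps)
    have "\<tau> = 1"
      using coords(1)[OF *] coords(2)[OF *] by simp
    then have t: "t = 1"
      using \<tau> image_scaleR_eq_self_D nz by simp
    \<comment> \<open>Now \<open>v\<close> and \<open>v - u\<close> have the same image, and the line through \<open>u\<close> and \<open>v - u\<close>
      contains \<open>v / 2\<close>.\<close>
    have "(1 / 2) *\<^sub>R v = u + (1 / 2) *\<^sub>R ((v - u) - u)"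
      by (simp add: algebra_simps flip: scaleR_add_left)
    then obtain k where "g ((1 / 2) *\<^sub>R v) = g u + k *\<^sub>R (g (v - u) - g u)"
      using image_on_line by metis
    moreover have "g (v - u) = g v"
      using const'[of "-1"] t \<open>\<tau> = 1\<close> by simp
    moreover obtain \<sigma> where \<sigma>: "g ((1 / 2) *\<^sub>R v) = \<sigma> *\<^sub>R g v"
      using image_scaleR by blast
    ultimately have **: "0 *\<^sub>R g u + \<sigma> *\<^sub>R g v = (1 - k) *\<^sub>R g u + k *\<^sub>R g v"
      by (simp add: algebra_simps)
    have "\<sigma> = 1"
      using coords(1)[OF **] coords(2)[OF **] by simp
    then show False
      using \<sigma> image_scaleR_eq_self_D[of "1 / 2" v] nz by simp
  qed
qed

text \<open>
  If the first coordinate of \<open>g (u + v)\<close> were not \<open>1\<close>, the line through \<open>g u\<close> and \<open>g (u + v)\<close>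
  would not be parallel to \<open>g v\<close> and would meet the line through \<open>0\<close> and \<open>g v\<close>.  Since both
  lines are images of whole lines, this contradicts \<open>parallel_images_disjoint\<close>.
\<close>

lemma first_coordinate_of_image_add:
  assumes ind: "g u \<noteq> g v \<and> independent {g u, g v}"
    and x: "g (u + v) = \<alpha> *\<^sub>R g u + \<beta> *\<^sub>R g v"
  shows "\<alpha> = 1"
proof (rule ccontr)
  assume \<alpha>: "\<alpha> \<noteq> 1"
  have "g u \<noteq> g (u + v)"
  proof
    assume "g u = g (u + v)"
    then have "1 *\<^sub>R g u + 0 *\<^sub>R g v = \<alpha> *\<^sub>R g u + \<beta> *\<^sub>R g v"
      using x by simp
    then show False
      using independent_pair_coords_unique(1)[OF ind] \<alpha> by blast
  qed
  \<comment> \<open>The parameter at which the first coordinate vanishes on the line through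
    \<open>g u\<close> and \<open>g (u + v)\<close>.\<close>
  define k where "k = 1 / (1 - \<alpha>)"
  obtain r where r: "g (u + r *\<^sub>R (u + v - u)) = g u + k *\<^sub>R (g (u + v) - g u)"
    using image_onto_line[OF \<open>g u \<noteq> g (u + v)\<close>] by blast
  have k: "1 + k * (\<alpha> - 1) = 0"
    using \<alpha> by (simp add: k_def field_simps)
  have "g u + k *\<^sub>R (g (u + v) - g u) = (1 + k * (\<alpha> - 1)) *\<^sub>R g u + (k * \<beta>) *\<^sub>R g v"
    by (simp add: x algebra_simps)
  then have "g (u + r *\<^sub>R v) = (k * \<beta>) *\<^sub>R g v"
    using r k by simp
  moreover have "g 0 \<noteq> g v"
    using ind dependent_zero[of "{g u, g v}"] by auto
  then obtain t where "g (0 + t *\<^sub>R (v - 0)) = g 0 + (k * \<beta>) *\<^sub>R (g v - g 0)"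
    using image_onto_line by blast
  ultimately show False
    using parallel_images_disjoint[OF ind, of r t] by simp
qed

lemma add_if_independent:
  assumes ind: "g u \<noteq> g v \<and> independent {g u, g v}"
  shows "g (u + v) = g u + g v"
proof -
  obtain k where k: "g ((1 / 2) *\<^sub>R (u + v)) = g u + k *\<^sub>R (g v - g u)"
    using image_on_line[of u "1 / 2" v] unfolding half_sum_on_line by blast
  \<comment> \<open>The point \<open>u + v\<close> is on the line through \<open>0\<close> and the midpoint, so its image is
    in the plane of \<open>g u\<close> and \<open>g v\<close>.\<close>
  have "u + v = 2 *\<^sub>R ((1 / 2) *\<^sub>R (u + v))"
    by simp
  then obtain l where "g (u + v) = l *\<^sub>R g ((1 / 2) *\<^sub>R (u + v))"
    using image_scaleR by metis
  then have x: "g (u + v) = (l * (1 - k)) *\<^sub>R g u + (l * k) *\<^sub>R g v"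
    unfolding k by (simp add: algebra_simps)
  have "l * (1 - k) = 1"
    using first_coordinate_of_image_add[OF ind x] .
  moreover have "l * k = 1"
  proof (rule first_coordinate_of_image_add)
    show "g v \<noteq> g u \<and> independent {g v, g u}"
      using ind by (metis insert_commute)
    show "g (v + u) = (l * k) *\<^sub>R g v + (l * (1 - k)) *\<^sub>R g u"
      using x by (simp add: add.commute)
  qed
  ultimately show ?thesis
    using x by simp
qed

text \<open>
  The midpoint lies on both diagonals of the parallelogram \<open>0\<close>, \<open>u\<close>, \<open>u + v\<close>, \<open>v\<close>, and the
  diagonals of the image parallelogram have only their common midpoint in common.
\<close>

lemma midpoint_if_independent:
  assumes ind: "g u \<noteq> g v \<and> independent {g u, g v}"
  shows "g ((1 / 2) *\<^sub>R (u + v)) = (1 / 2) *\<^sub>R (g u + g v)"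
proof -
  obtain k where k: "g ((1 / 2) *\<^sub>R (u + v)) = g u + k *\<^sub>R (g v - g u)"
    using image_on_line[of u "1 / 2" v] unfolding half_sum_on_line by blast
  obtain l where l: "g ((1 / 2) *\<^sub>R (u + v)) = l *\<^sub>R g (u + v)"
    using image_scaleR by blast
  have *: "(1 - k) *\<^sub>R g u + k *\<^sub>R g v = l *\<^sub>R g u + l *\<^sub>R g v"
    using k l add_if_independent[OF ind] by (simp add: algebra_simps)
  have "l = 1 / 2"
    using independent_pair_coords_unique[OF ind *] by simp
  then show ?thesis
    using l add_if_independent[OF ind] by simp
qed

end

context line_betweenness_map
begin

text \<open>
  If \<open>g a = g b\<close>, then \<open>g\<close> is constant on the line through \<open>a\<close> and \<open>b\<close>.  Otherwise, as the
  image of \<open>g\<close> is not contained in a line, some \<open>c\<close> has its image off the line through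
  \<open>g a\<close> and \<open>g b\<close>; seen from \<open>c\<close> as origin, the images of \<open>a\<close> and \<open>b\<close> are independent.
\<close>

lemma midpoint_preserved:
  assumes "\<exists>a a0 a1. g a0 - g a \<noteq> g a1 - g a \<and> independent {g a0 - g a, g a1 - g a}"
  shows "g ((1 / 2) *\<^sub>R (a + b)) = (1 / 2) *\<^sub>R (g a + g b)"
proof (cases "g a = g b")
  case True
  have "g ((1 / 2) *\<^sub>R (a + b)) = g a"
    unfolding half_sum_on_line using const_on_line[OF True, of "1 / 2"] by (cases "a = b") auto
  then show ?thesis
    using True by (simp flip: scaleR_2)
next
  case False
  define D where "D = g b - g a"
  obtain c where c: "g c - g a \<notin> span {D}"
  proof (rule ccontr)
    assume "\<not> thesis"
    then have all: "g c - g a \<in> span {D}" for c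
      using that by blast
    \<comment> \<open>All differences of values would lie in a space of dimension one.\<close>
    have diff: "g p - g q \<in> span {D}" for p q
      using span_diff[OF all[of p] all[of q]] by simp
    obtain p q0 q1 where q: "g q0 - g p \<noteq> g q1 - g p" "independent {g q0 - g p, g q1 - g p}"
      using assms by blast
    then have "card {g q0 - g p, g q1 - g p} \<le> card {D}"
      using independent_span_bound[of "{D}" "{g q0 - g p, g q1 - g p}"] diff by simp
    then show False
      using q by simp
  qed
  define h where "h x = g (c + x) - g c" for x
  interpret h: pointed_line_betweenness_map h
    unfolding pointed_line_betweenness_map_def pointed_line_betweenness_map_axioms_def h_def
    using translate by simp
  have h: "h (a - c) = g a - g c" "h (b - c) = g b - g c"
    by (simp_all add: h_def)
  have "h (a - c) \<noteq> h (b - c) \<and> independent {h (a - c), h (b - c)}"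
    unfolding independent_pair_iff h
  proof (intro allI impI)
    fix \<alpha> \<beta> :: real
    assume *: "\<alpha> *\<^sub>R (g a - g c) + \<beta> *\<^sub>R (g b - g c) = 0"
    have eq: "(\<alpha> + \<beta>) *\<^sub>R (g c - g a) = \<beta> *\<^sub>R D"
      using * by (simp add: D_def algebra_simps)
    have sum: "\<alpha> + \<beta> = 0"
    proof (rule ccontr)
      assume nz: "\<alpha> + \<beta> \<noteq> 0"
      have "g c - g a = (1 / (\<alpha> + \<beta>)) *\<^sub>R ((\<alpha> + \<beta>) *\<^sub>R (g c - g a))"
        using nz by simp
      also have "\<dots> = (\<beta> / (\<alpha> + \<beta>)) *\<^sub>R D"
        by (simp add: eq)
      finally show False
        using c by (auto simp: span_singleton)
    qed
    then have "\<beta> = 0"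
      using eq False by (simp add: D_def)
    then show "\<alpha> = 0 \<and> \<beta> = 0"
      using sum by simp
  qed
  from h.midpoint_if_independent[OF this]
  have "g (c + (1 / 2) *\<^sub>R (a - c + (b - c))) - g c = (1 / 2) *\<^sub>R (g a - g c + (g b - g c))"
    by (simp add: h_def)
  moreover have "c + (1 / 2) *\<^sub>R (a - c + (b - c)) = (1 / 2) *\<^sub>R (a + b)"
    by (simp add: algebra_simps flip: scaleR_add_left)
  moreover have "(1 / 2) *\<^sub>R (g a - g c + (g b - g c)) = (1 / 2) *\<^sub>R (g a + g b) - g c"
    by (simp add: algebra_simps flip: scaleR_add_left)
  ultimately show ?thesis
    by simp
qed

end

section \<open>From midpoints to linearity\<close>

text \<open>
  Additivity and \<open>\<phi> 1 = 1\<close> give \<open>\<phi> q = q\<close> for rational \<open>q\<close>, and positivity makes \<open>\<phi>\<close>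
  strictly monotone.  A rational strictly between \<open>x\<close> and \<open>\<phi> x\<close> would contradict monotonicity.
\<close>

lemma additive_positive_real_is_identity:
  fixes \<phi> :: "real \<Rightarrow> real"
  assumes add: "\<And>x y. \<phi> (x + y) = \<phi> x + \<phi> y"
    and one: "\<phi> 1 = 1"
    and pos: "\<And>x. x > 0 \<Longrightarrow> \<phi> x > 0"
  shows "\<phi> x = x"
proof -
  interpret additive \<phi>
    by standard (rule add)
  have nat: "\<phi> (real n * y) = real n * \<phi> y" for n y
    by (induction n) (simp_all add: zero add ring_distribs)
  have int: "\<phi> (of_int m) = of_int m" for m
    using nat[of _ 1] by (cases m rule: int_cases2) (simp_all add: one minus)
  have rat: "\<phi> q = q" if "q \<in> \<rat>" for q
  proof -
    from that obtain m n where mn: "n > 0" "q = of_int m / of_int n"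
      by (auto elim: Rats_cases')
    then have "of_int n * \<phi> q = \<phi> (of_int n * q)"
      using nat[of "nat n" q] by simp
    also have "\<dots> = of_int m"
      using mn int by simp
    finally have "\<phi> q = of_int m / of_int n"
      using mn(1) by (simp add: field_simps)
    then show ?thesis
      using mn(2) by simp
  qed
  have mono: "\<phi> y < \<phi> z" if "y < z" for y z
    using pos[of "z - y"] that by (simp add: diff)
  show ?thesis
  proof (rule ccontr)
    assume "\<phi> x \<noteq> x"
    then consider "\<phi> x < x" | "x < \<phi> x"
      by linarith
    then show False
    proof cases
      case 1
      then obtain q where "q \<in> \<rat>" "\<phi> x < q" "q < x"
        using Rats_dense_in_real by blast
      then show False
        using mono[of q x] rat by simp
    next
      case 2
      then obtain q where "q \<in> \<rat>" "x < q" "q < \<phi> x"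
        using Rats_dense_in_real by blast
      then show False
        using mono[of x q] rat by simp
    qed
  qed
qed

context pointed_line_betweenness_map
begin

text \<open>
  If \<open>g x \<noteq> 0\<close>, then \<open>g (r x) = \<phi>(r) g x\<close> for an additive \<open>\<phi>\<close>.  For \<open>s > 0\<close> the origin
  separates \<open>- x\<close> from \<open>s x\<close>, hence \<open>- g x\<close> from \<open>\<phi>(s) g x\<close>, which means \<open>\<phi>(s) > 0\<close>.
\<close>

lemma linear_if_additive:
  assumes add: "\<And>x y. g (x + y) = g x + g y"
  shows "linear g"
proof (rule linearI)
  fix r :: real and x :: 'a
  show "g (r *\<^sub>R x) = r *\<^sub>R g x"
  proof (cases "g x = 0")
    case True
    then show ?thesis
      using image_scaleR[of r x] by auto
  next
    case False
    have "\<forall>r. \<exists>s. g (r *\<^sub>R x) = s *\<^sub>R g x"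
      using image_scaleR by blast
    from choice[OF this] obtain \<phi> where \<phi>: "\<And>r. g (r *\<^sub>R x) = \<phi> r *\<^sub>R g x"
      by blast
    have "x \<noteq> 0"
      using False by auto
    interpret additive g
      by standard (rule add)
    have "\<phi> r = r"
    proof (rule additive_positive_real_is_identity)
      fix s t
      have "\<phi> (s + t) *\<^sub>R g x = (\<phi> s + \<phi> t) *\<^sub>R g x"
        by (simp add: scaleR_add_left add flip: \<phi>)
      then show "\<phi> (s + t) = \<phi> s + \<phi> t"
        using False by simp
    next
      show "\<phi> 1 = 1"
        using \<phi>[of 1] False by (metis scaleR_one scaleR_cancel_right)
    next
      fix s :: real
      assume s: "s > 0"
      have "s *\<^sub>R x - (- x) = (1 + s) *\<^sub>R x"
        by (simp add: scaleR_add_left)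
      moreover have "(1 + s) *\<^sub>R x \<noteq> 0"
        using s \<open>x \<noteq> 0\<close> by simp
      ultimately have "- x \<noteq> s *\<^sub>R x"
        by (metis diff_self)
      then have "0 \<in> open_segment (- x) (s *\<^sub>R x)"
        using s by (intro in_open_segmentI[of s 1]) auto
      then have "g 0 \<in> open_segment (g (- x)) (g (s *\<^sub>R x))"
        using image_between[of 0 "- x" "s *\<^sub>R x"] False by (auto simp: minus)
      then have "0 \<in> open_segment (- g x) (\<phi> s *\<^sub>R g x)"
        by (simp add: \<phi> minus)
      then obtain u where u: "0 < u" "u < 1" "0 = (1 - u) *\<^sub>R (- g x) + u *\<^sub>R (\<phi> s *\<^sub>R g x)"
        by (auto simp: in_segment)
      then have "(u * \<phi> s - (1 - u)) *\<^sub>R g x = 0"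
        by (simp add: algebra_simps)
      then have "u * \<phi> s = 1 - u"
        using False by simp
      then show "\<phi> s > 0"
        using u by (metis diff_gt_0_iff_gt zero_less_mult_pos)
    qed
    then show ?thesis
      by (simp add: \<phi>)
  qed
qed (rule add)

end

lemma (in line_betweenness_map) affine_map_if_noncollinear:
  assumes "\<exists>a a0 a1. g a0 - g a \<noteq> g a1 - g a \<and> independent {g a0 - g a, g a1 - g a}"
  shows "affine_map g"
proof -
  define f where "f x = g x - g 0" for x
  interpret f: pointed_line_betweenness_map f
    unfolding pointed_line_betweenness_map_def pointed_line_betweenness_map_axioms_def f_def
    using translate[of 0] by simp
  have mid: "f ((1 / 2) *\<^sub>R (x + y)) = (1 / 2) *\<^sub>R (f x + f y)" for x y
    unfolding f_def midpoint_preserved[OF assms]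
    by (simp add: algebra_simps flip: scaleR_add_left)
  \<comment> \<open>Since \<open>f 0 = 0\<close>, the midpoint of \<open>x + y\<close> and \<open>0\<close> shows that \<open>f\<close> commutes with halving.\<close>
  have "f (x + y) = f x + f y" for x y
    using mid[of x y] mid[of "x + y" 0] by simp
  then have "linear f"
    by (rule f.linear_if_additive)
  moreover have "g x = f x + g 0" for x
    by (simp add: f_def)
  ultimately show ?thesis
    unfolding affine_map_def by blast
qed

theorem corollary4p3:
  fixes g :: "'x::real_vector \<Rightarrow> 'y::real_vector"
  assumes "\<exists>a a0 a1. g a0 - g a \<noteq> g a1 - g a \<and> independent {g a0 - g a, g a1 - g a}"
  shows "affine_map g \<longleftrightarrow>
    (\<forall>L. is_line L \<longrightarrow> is_singleton (g ` L) \<or> is_line (g ` L)) \<and>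
    (\<forall>a b c. c \<in> open_segment a b \<longrightarrow>
       (g a = g b \<and> g b = g c) \<or> g c \<in> open_segment (g a) (g b))"
proof
  assume "affine_map g"
  then show "(\<forall>L. is_line L \<longrightarrow> is_singleton (g ` L) \<or> is_line (g ` L)) \<and>
    (\<forall>a b c. c \<in> open_segment a b \<longrightarrow>
       (g a = g b \<and> g b = g c) \<or> g c \<in> open_segment (g a) (g b))"
    using affine_map_image_line affine_map_open_segment by blast
next
  assume "(\<forall>L. is_line L \<longrightarrow> is_singleton (g ` L) \<or> is_line (g ` L)) \<and>
    (\<forall>a b c. c \<in> open_segment a b \<longrightarrow>
       (g a = g b \<and> g b = g c) \<or> g c \<in> open_segment (g a) (g b))"
  then interpret line_betweenness_map g
    by unfold_locales blast+
  show "affine_map g"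
    using assms by (rule affine_map_if_noncollinear)
qed

end
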